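(* Let $(X,\tau)$ be a topological space, let $L$ be the convergence on $X$ induced by $\tau$, and let $\nu\in\{1,\mathrm{fin}\}$. Then each of the games $\mathsf G_\nu(\mathcal C_L,\mathcal C_L)$ and $\mathsf G_\nu(\mathcal C_L,\operatorname{Cov}(X))$ is strategically equivalent to $\mathsf G_\nu(\mathcal O(X,\tau),\mathcal O(X,\tau))$. Moreover, the corresponding selection principles are equivalent: each of $\mathsf S_\nu(\mathcal C_L,\mathcal C_L)$ and $\mathsf S_\nu(\mathcal C_L,\operatorname{Cov}(X))$ holds if and only if $\mathsf S_\nu(\mathcal O(X,\tau),\mathcal O(X,\tau))$ holds.
   Context: All filters are proper. $\operatorname{Fil}(X)$ is the set of filters on $X$, and $\dot x=\{A\subseteq X:x\in A\}$. A convergence on $X$ is a function $L:\operatorname{Fil}(X)\to\mathcal P(X)$ such that $x\in L(\dot x)$ for every $x\in X$, and $L(\mathcal F)\subseteq L(\mathcal G)$ whenever $\mathcal F\subseteq\mathcal G$; write $\mathcal F\to_L x$ for $x\in L(\mathcal F)$. The convergence induced by a topology $\tau$ is given by: $\mathcal F\to_L x$ iff $\mathcal N_\tau(x)\subseteq\mathcal F$, where $\mathcal N_\tau(x)$ is the neighborhood filter of $x$. Put $\Sigma_L=\{\mathcal F\in\operatorname{Fil}(X):L(\mathcal F)\neq\varnothing\}$. A family $\mathcal U\subseteq\mathcal P(X)$ is an $L$-cover if $\mathcal U\cap\mathcal F\neq\varnothing$ for every $\mathcal F\in\Sigma_L$; $\mathcal C_L$ is the family of all $L$-covers. $\operatorname{Cov}(X)$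 is the family of all covers of $X$ by subsets of $X$. $\mathcal O(X,\tau)$ is the family of all open covers of $(X,\tau)$ (covers containing $X$ itself are allowed). For collections $\mathcal A,\mathcal B$ of families of sets: $\mathsf S_1(\mathcal A,\mathcal B)$ asserts that for every sequence $\langle\mathcal U_n:n<\omega\rangle$ in $\mathcal A$ there are $U_n\in\mathcal U_n$ with $\{U_n:n<\omega\}\in\mathcal B$; $\mathsf S_{\mathrm{fin}}(\mathcal A,\mathcal B)$ asserts that there are finite $\mathcal V_n\subseteq\mathcal U_n$ with $\bigcup_{n<\omega}\mathcal V_n\in\mathcal B$. In the game $\mathsf G_1(\mathcal A,\mathcal B)$ (resp. $\mathsf G_{\mathrm{fin}}(\mathcal A,\mathcal B)$), in each inning $n<\omega$ Alice chooses $\mathcal U_n\in\mathcal A$ and then Bob chooses a member (resp. a finite subfamily) of $\mathcal U_n$; Bob wins if the family of all sets he selected belongs to $\mathcal B$, otherwise Alice wins. Two games are strategically equivalent if Alice has a winning strategy in one iff she has one in the other, and likewise for Bob. *)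

theory Defs
  imports "HOL-Analysis.Abstract_Limits"
begin

section \<open>Convergences\<close>

text \<open>
  Library filters are ordered by reverse inclusion of the underlying set families: for filters
  \<open>F\<close>, \<open>G\<close>, the inclusion of families \<open>F \<subseteq> G\<close> is \<open>G \<le> F\<close>, and \<open>A\<close> belongs to \<open>F\<close> iff
  \<open>eventually (\<lambda>x. x \<in> A) F\<close>. The filters on a carrier \<open>X\<close> are those concentrated on \<open>X\<close>.
  Properness has to be requested, since the library also admits the improper filter \<open>bot\<close>.
\<close>

definition Fil :: "'a set \<Rightarrow> 'a filter set" where
  "Fil X = {F. F \<noteq> bot \<and> F \<le> principal X}"

definition filter_sets :: "'a set \<Rightarrow> 'a filter \<Rightarrow> 'a set set" where
  "filter_sets X F = {A. A \<subseteq> X \<and> eventually (\<lambda>x. x \<in> A) F}"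

text \<open>\<open>principal {x}\<close> is the filter of all sets containing \<open>x\<close>. Values of \<open>L\<close> outside \<open>Fil X\<close>
  are irrelevant.\<close>

definition convergence_on :: "'a set \<Rightarrow> ('a filter \<Rightarrow> 'a set) \<Rightarrow> bool" where
  "convergence_on X L \<longleftrightarrow>
     (\<forall>F\<in>Fil X. L F \<subseteq> X) \<and>
     (\<forall>x\<in>X. x \<in> L (principal {x})) \<and>
     (\<forall>F\<in>Fil X. \<forall>G\<in>Fil X. G \<le> F \<longrightarrow> L F \<subseteq> L G)"

text \<open>\<open>nhdsin T x\<close> is the neighbourhood filter of \<open>x\<close>.\<close>

definition induced_convergence :: "'a topology \<Rightarrow> 'a filter \<Rightarrow> 'a set" where
  "induced_convergence T F = {x \<in> topspace T. F \<le> nhdsin T x}"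

lemma convergence_on_induced_convergence:
  "convergence_on (topspace T) (induced_convergence T)"
proof -
  have "principal {x} \<le> nhdsin T x" if "x \<in> topspace T" for x
    using that by (auto simp: le_filter_def eventually_nhdsin eventually_principal)
  then show ?thesis
    by (auto simp: convergence_on_def induced_convergence_def intro: order_trans)
qed

lemma induced_convergence_iff_neighbourhoods:
  assumes "F \<in> Fil (topspace T)" "x \<in> topspace T"
  shows "x \<in> induced_convergence T F \<longleftrightarrow>
    {N. N \<subseteq> topspace T \<and> (\<exists>V. openin T V \<and> x \<in> V \<and> V \<subseteq> N)} \<subseteq> filter_sets (topspace T) F"
    (is "_ \<longleftrightarrow> ?N \<subseteq> _")
proof
  assume "x \<in> induced_convergence T F"
  then have le: "F \<le> nhdsin T x" by (simp add: induced_convergence_def)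
  show "?N \<subseteq> filter_sets (topspace T) F"
  proof
    fix N assume "N \<in> ?N"
    then have "eventually (\<lambda>y. y \<in> N) (nhdsin T x)" and "N \<subseteq> topspace T"
      using assms(2) by (auto simp: eventually_nhdsin)
    then show "N \<in> filter_sets (topspace T) F"
      using le by (auto simp: filter_sets_def le_filter_def)
  qed
next
  assume sub: "?N \<subseteq> filter_sets (topspace T) F"
  have "F \<le> nhdsin T x"
  proof (rule filter_leI)
    fix P assume "eventually P (nhdsin T x)"
    then obtain V where V: "openin T V" "x \<in> V" "\<forall>y\<in>V. P y"
      using assms(2) by (auto simp: eventually_nhdsin)
    then have "V \<in> ?N" using openin_subset by blast
    then have "eventually (\<lambda>y. y \<in> V) F" using sub by (auto simp: filter_sets_def)
    then show "eventually P F" by (rule eventually_mono) (use V in auto)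
  qed
  then show "x \<in> induced_convergence T F"
    using assms(2) by (simp add: induced_convergence_def)
qed

definition convergent_filters :: "'a set \<Rightarrow> ('a filter \<Rightarrow> 'a set) \<Rightarrow> 'a filter set" where
  "convergent_filters X L = {F \<in> Fil X. L F \<noteq> {}}"


section \<open>Covers\<close>

definition conv_covers :: "'a set \<Rightarrow> ('a filter \<Rightarrow> 'a set) \<Rightarrow> 'a set set set" where
  "conv_covers X L =
     {\<U>. \<U> \<subseteq> Pow X \<and> (\<forall>F \<in> convergent_filters X L. \<U> \<inter> filter_sets X F \<noteq> {})}"

definition all_covers :: "'a set \<Rightarrow> 'a set set set" where
  "all_covers X = {\<U>. \<U> \<subseteq> Pow X \<and> \<Union>\<U> = X}"

definition open_covers :: "'a topology \<Rightarrow> 'a set set set" where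
  "open_covers T = {\<U>. (\<forall>U\<in>\<U>. openin T U) \<and> \<Union>\<U> = topspace T}"


section \<open>Selection principles\<close>

definition S1 :: "'a set set set \<Rightarrow> 'a set set set \<Rightarrow> bool" where
  "S1 \<A> \<B> \<longleftrightarrow>
     (\<forall>\<U> :: nat \<Rightarrow> 'a set set. (\<forall>n. \<U> n \<in> \<A>) \<longrightarrow>
        (\<exists>U. (\<forall>n. U n \<in> \<U> n) \<and> range U \<in> \<B>))"

definition Sfin :: "'a set set set \<Rightarrow> 'a set set set \<Rightarrow> bool" where
  "Sfin \<A> \<B> \<longleftrightarrow>
     (\<forall>\<U> :: nat \<Rightarrow> 'a set set. (\<forall>n. \<U> n \<in> \<A>) \<longrightarrow>
        (\<exists>\<V>. (\<forall>n. finite (\<V> n) \<and> \<V> n \<subseteq> \<U> n) \<and> (\<Union>n. \<V> n) \<in> \<B>))"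


section \<open>Selection games\<close>

text \<open>
  A game of length \<open>\<omega>\<close> consists of Alice's moves, Bob's legal answers to each of Alice's moves,
  and the set of sequences of answers with which Bob wins.
\<close>

record ('m, 'r) game =
  moves :: "'m set"
  answers :: "'m \<Rightarrow> 'r set"
  bob_wins :: "(nat \<Rightarrow> 'r) set"

definition G1 :: "'a set set set \<Rightarrow> 'a set set set \<Rightarrow> ('a set set, 'a set) game" where
  "G1 \<A> \<B> = \<lparr>moves = \<A>, answers = (\<lambda>\<U>. \<U>), bob_wins = {U. range U \<in> \<B>}\<rparr>"

definition Gfin :: "'a set set set \<Rightarrow> 'a set set set \<Rightarrow> ('a set set, 'a set set) game" where
  "Gfin \<A> \<B> = \<lparr>moves = \<A>, answers = (\<lambda>\<U>. {\<V>. finite \<V> \<and> \<V> \<subseteq> \<U>}),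
                bob_wins = {\<V>. (\<Union>n. \<V> n) \<in> \<B>}\<rparr>"

text \<open>
  A strategy for Alice maps the list of Bob's previous answers to her next move, and must be legal
  at each position that can arise when she follows it. A strategy for Bob maps the list of all of
  Alice's moves so far, including the current one, to his answer. A player who has no legal move
  loses: this matters only if Alice can play the empty family in \<open>G1\<close>, that is, for covers of the
  empty space.
\<close>

definition alice_strategy :: "('m, 'r) game \<Rightarrow> ('r list \<Rightarrow> 'm) \<Rightarrow> bool" where
  "alice_strategy G \<sigma> \<longleftrightarrow>
     (\<forall>rs. (\<forall>i<length rs. rs ! i \<in> answers G (\<sigma> (take i rs))) \<longrightarrow> \<sigma> rs \<in> moves G)"

definition alice_has_winning_strategy :: "('m, 'r) game \<Rightarrow> bool" where
  "alice_has_winning_strategy G \<longleftrightarrow>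
     (\<exists>\<sigma>. alice_strategy G \<sigma> \<and>
        (\<forall>r. (\<forall>n. r n \<in> answers G (\<sigma> (map r [0..<n]))) \<longrightarrow> r \<notin> bob_wins G))"

definition bob_strategy :: "('m, 'r) game \<Rightarrow> ('m list \<Rightarrow> 'r) \<Rightarrow> bool" where
  "bob_strategy G \<sigma> \<longleftrightarrow>
     (\<forall>ms m. set ms \<subseteq> moves G \<longrightarrow> m \<in> moves G \<longrightarrow> \<sigma> (ms @ [m]) \<in> answers G m)"

definition bob_has_winning_strategy :: "('m, 'r) game \<Rightarrow> bool" where
  "bob_has_winning_strategy G \<longleftrightarrow>
     (\<exists>\<sigma>. bob_strategy G \<sigma> \<and>
        (\<forall>m. (\<forall>n. m n \<in> moves G) \<longrightarrow> (\<lambda>n. \<sigma> (map m [0..<Suc n])) \<in> bob_wins G))"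

definition strategically_equivalent :: "('m, 'r) game \<Rightarrow> ('n, 's) game \<Rightarrow> bool" where
  "strategically_equivalent G H \<longleftrightarrow>
     (alice_has_winning_strategy G \<longleftrightarrow> alice_has_winning_strategy H) \<and>
     (bob_has_winning_strategy G \<longleftrightarrow> bob_has_winning_strategy H)"

end

theory Submission
  imports Defs
begin

text \<open>
  A family is a cover for the induced convergence iff the interiors of its members cover the space.
  Hence Bob may carry a strategy from one game to the next around the cycle
  \<open>(\<C>, \<C>) \<rightarrow> (\<C>, Cov) \<rightarrow> (\<O>, \<O>) \<rightarrow> (\<C>, \<C>)\<close>: the first two arrows need no translation, and for the
  third he replaces Alice's family by the family of interiors and answers with members whose
  interiors are the sets selected there. The same translation carries strategies of Alice around the
  cycle backwards, and selectors forwards.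
\<close>

section \<open>Reductions between games\<close>

text \<open>Moves translate from \<open>H\<close> back to \<open>G\<close> and answers from
  \<open>G\<close> to \<open>H\<close>, inning by inning, so one notion serves both players and
  selectors. \<open>g\<close> also takes \<open>m\<close>, because a legal answer depends on the
  family Alice played.\<close>

definition game_reduction ::
    "('m, 'r) game \<Rightarrow> ('n, 's) game \<Rightarrow> ('n \<Rightarrow> 'm) \<Rightarrow> ('n \<Rightarrow> 'r \<Rightarrow> 's) \<Rightarrow> bool" where
  "game_reduction G H f g \<longleftrightarrow>
     (\<forall>m\<in>moves H. f m \<in> moves G) \<and>
     (\<forall>m\<in>moves H. \<forall>r\<in>answers G (f m). g m r \<in> answers H m) \<and>
     (\<forall>m r. (\<forall>n. m n \<in> moves H) \<longrightarrow> (\<forall>n. r n \<in> answers G (f (m n))) \<longrightarrow> r \<in> bob_wins G \<longrightarrow>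
        (\<lambda>n. g (m n) (r n)) \<in> bob_wins H)"

definition reducible :: "('m, 'r) game \<Rightarrow> ('n, 's) game \<Rightarrow> bool" where
  "reducible G H \<longleftrightarrow> (\<exists>f g. game_reduction G H f g)"

text \<open>A common form of \<open>S1\<close> and \<open>Sfin\<close>: Bob can win when Alice's
  whole sequence of moves is known in advance.\<close>

definition selection_principle :: "('m, 'r) game \<Rightarrow> bool" where
  "selection_principle G \<longleftrightarrow>
     (\<forall>m. (\<forall>n. m n \<in> moves G) \<longrightarrow> (\<exists>r. (\<forall>n. r n \<in> answers G (m n)) \<and> r \<in> bob_wins G))"

lemma selection_principle_reducible:
  assumes "reducible G H" and "selection_principle G"
  shows "selection_principle H"
proof -
  obtain f g where red: "game_reduction G H f g"
    using assms(1) by (auto simp: reducible_def)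
  show ?thesis
    unfolding selection_principle_def
  proof (intro allI impI)
    fix m :: "nat \<Rightarrow> _" assume m: "\<forall>n. m n \<in> moves H"
    then have "\<forall>n. f (m n) \<in> moves G"
      using red by (simp add: game_reduction_def)
    then obtain r where r: "\<forall>n. r n \<in> answers G (f (m n))" "r \<in> bob_wins G"
      using assms(2)[unfolded selection_principle_def, rule_format, of "\<lambda>n. f (m n)"] by blast
    show "\<exists>s. (\<forall>n. s n \<in> answers H (m n)) \<and> s \<in> bob_wins H"
      using red m r by (intro exI[of _ "\<lambda>n. g (m n) (r n)"]) (simp add: game_reduction_def)
  qed
qed

text \<open>Bob pretends that Alice plays the \<open>f\<close>-images of her moves in
  \<open>G\<close>, and translates his winning answers by \<open>g\<close>.\<close>

lemma bob_has_winning_strategy_reducible: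
  assumes "reducible G H" and "bob_has_winning_strategy G"
  shows "bob_has_winning_strategy H"
proof -
  obtain f g where red: "game_reduction G H f g"
    using assms(1) by (auto simp: reducible_def)
  obtain \<sigma> where strat: "bob_strategy G \<sigma>"
    and win: "\<And>m. \<forall>n. m n \<in> moves G \<Longrightarrow> (\<lambda>n. \<sigma> (map m [0..<Suc n])) \<in> bob_wins G"
    using assms(2) by (auto simp: bob_has_winning_strategy_def)
  have f: "\<And>m. m \<in> moves H \<Longrightarrow> f m \<in> moves G"
    and g: "\<And>m r. m \<in> moves H \<Longrightarrow> r \<in> answers G (f m) \<Longrightarrow> g m r \<in> answers H m"
    using red by (auto simp: game_reduction_def)
  have legal: "\<sigma> (map f (ms @ [m])) \<in> answers G (f m)"
    if "set ms \<subseteq> moves H" "m \<in> moves H" for ms m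
  proof -
    have "set (map f ms) \<subseteq> moves G" "f m \<in> moves G"
      using f that by auto
    then show ?thesis
      using strat by (simp add: bob_strategy_def)
  qed
  \<comment> \<open>Bob's history includes the current move, so \<open>last ms\<close> is the move
    to be answered; the empty list never occurs.\<close>
  define \<tau> where "\<tau> ms = g (last ms) (\<sigma> (map f ms))" for ms
  have "bob_strategy H \<tau>"
    unfolding bob_strategy_def \<tau>_def using legal g by simp
  moreover have "(\<lambda>n. \<tau> (map m [0..<Suc n])) \<in> bob_wins H" if m: "\<forall>n. m n \<in> moves H" for m
  proof -
    define r where "r n = \<sigma> (map (\<lambda>k. f (m k)) [0..<Suc n])" for n
    have "r n \<in> answers G (f (m n))" for n
      using legal[of "map m [0..<n]" "m n"] m by (auto simp: r_def comp_def)
    moreover have "r \<in> bob_wins G"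
      unfolding r_def using win[of "\<lambda>k. f (m k)"] m f by blast
    ultimately have "(\<lambda>n. g (m n) (r n)) \<in> bob_wins H"
      using red m by (simp add: game_reduction_def)
    then show ?thesis
      by (simp add: \<tau>_def r_def comp_def)
  qed
  ultimately show ?thesis
    by (auto simp: bob_has_winning_strategy_def)
qed

text \<open>Alice plays in \<open>G\<close> the \<open>f\<close>-images of the moves that her
  strategy makes in a simulated run of \<open>H\<close>, into which Bob's answers are fed through
  \<open>g\<close>.\<close>

lemma alice_has_winning_strategy_reducible:
  assumes "reducible G H" and "alice_has_winning_strategy H"
  shows "alice_has_winning_strategy G"
proof -
  obtain f g where red: "game_reduction G H f g"
    using assms(1) by (auto simp: reducible_def)
  obtain \<sigma> where strat: "alice_strategy H \<sigma>"
    and win: "\<And>r. \<forall>n. r n \<in> answers H (\<sigma> (map r [0..<n])) \<Longrightarrow> r \<notin> bob_wins H"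
    using assms(2) by (auto simp: alice_has_winning_strategy_def)
  have f: "\<And>m. m \<in> moves H \<Longrightarrow> f m \<in> moves G"
    and g: "\<And>m r. m \<in> moves H \<Longrightarrow> r \<in> answers G (f m) \<Longrightarrow> g m r \<in> answers H m"
    using red by (auto simp: game_reduction_def)
  \<comment> \<open>The simulated history is built recursively, oldest answer first:
    \<open>g\<close> needs the move that \<open>\<sigma>\<close> makes after the part already
    translated.\<close>
  define h where "h = foldl (\<lambda>ss r. ss @ [g (\<sigma> ss) r]) []"
  have h_Nil: "h [] = []" and h_snoc: "\<And>rs r. h (rs @ [r]) = h rs @ [g (\<sigma> (h rs)) r]"
    by (simp_all add: h_def)
  define \<tau> where "\<tau> rs = f (\<sigma> (h rs))" for rs
  define legal where "legal ss \<longleftrightarrow> (\<forall>i<length ss. ss ! i \<in> answers H (\<sigma> (take i ss)))" for ss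
  have legal_move: "\<sigma> ss \<in> moves H" if "legal ss" for ss
    using strat that by (simp add: alice_strategy_def legal_def)
  \<comment> \<open>\<open>\<sigma>\<close> is known to be legal only at reachable positions.
    Legality of the shorter translated history puts the current move in \<open>moves H\<close>,
    which \<open>g\<close> requires for the next answer.\<close>
  have legal_h: "legal (h rs)" if "\<forall>i<length rs. rs ! i \<in> answers G (\<tau> (take i rs))" for rs
    using that
  proof (induction rs rule: rev_induct)
    case Nil
    then show ?case by (simp add: legal_def h_Nil)
  next
    case (snoc r rs)
    have "\<forall>i<length rs. rs ! i \<in> answers G (\<tau> (take i rs))"
    proof (intro allI impI)
      fix i assume "i < length rs"
      then show "rs ! i \<in> answers G (\<tau> (take i rs))"
        using snoc.prems[rule_format, of i] by (simp add: nth_append)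
    qed
    then have IH: "legal (h rs)" by (rule snoc.IH)
    have "r \<in> answers G (\<tau> rs)"
      using snoc.prems[rule_format, of "length rs"] by simp
    then have "g (\<sigma> (h rs)) r \<in> answers H (\<sigma> (h rs))"
      using g legal_move[OF IH] by (simp add: \<tau>_def)
    with IH show ?case
      by (auto simp: legal_def h_snoc nth_append less_Suc_eq)
  qed
  have "alice_strategy G \<tau>"
    unfolding alice_strategy_def using f legal_move legal_h by (auto simp: \<tau>_def)
  moreover have "r \<notin> bob_wins G" if r: "\<forall>n. r n \<in> answers G (\<tau> (map r [0..<n]))" for r
  proof
    assume bob: "r \<in> bob_wins G"
    define m where "m n = \<sigma> (h (map r [0..<n]))" for n
    define s where "s n = g (m n) (r n)" for n
    \<comment> \<open>The translated histories are the initial segments of the one sequence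
      \<open>s\<close>, which can thus be played against \<open>\<sigma>\<close>.\<close>
    have hs: "h (map r [0..<n]) = map s [0..<n]" for n
      by (induction n) (simp_all add: h_Nil h_snoc s_def m_def)
    have m: "m n \<in> moves H" for n
      unfolding m_def using r by (intro legal_move legal_h) (simp add: take_map)
    have rm: "r n \<in> answers G (f (m n))" for n
      using r by (simp add: \<tau>_def m_def)
    have "s n \<in> answers H (\<sigma> (map s [0..<n]))" for n
      using g[OF m rm, of n] by (simp add: s_def m_def hs)
    then have "s \<notin> bob_wins H" using win by blast
    moreover have "s \<in> bob_wins H"
      using red m rm bob unfolding game_reduction_def s_def by blast
    ultimately show False by contradiction
  qed
  ultimately show ?thesis
    by (auto simp: alice_has_winning_strategy_def)
qed

text \<open>Bob's strategies and selectors travel forwards and Alice's strategies backwards; around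
  a cycle the implications close up to equivalences.\<close>

lemma reducible_cycle:
  assumes "reducible G\<^sub>1 G\<^sub>2" "reducible G\<^sub>2 G\<^sub>3" "reducible G\<^sub>3 G\<^sub>1"
  shows "strategically_equivalent G\<^sub>1 G\<^sub>3" "strategically_equivalent G\<^sub>2 G\<^sub>3"
    and "selection_principle G\<^sub>1 \<longleftrightarrow> selection_principle G\<^sub>3"
    and "selection_principle G\<^sub>2 \<longleftrightarrow> selection_principle G\<^sub>3"
  using assms[THEN alice_has_winning_strategy_reducible]
    assms[THEN bob_has_winning_strategy_reducible]
    assms[THEN selection_principle_reducible]
  unfolding strategically_equivalent_def by blast+

lemma selection_principle_G1: "selection_principle (G1 \<A> \<B>) \<longleftrightarrow> S1 \<A> \<B>"
  by (simp add: selection_principle_def G1_def S1_def)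

lemma selection_principle_Gfin: "selection_principle (Gfin \<A> \<B>) \<longleftrightarrow> Sfin \<A> \<B>"
  by (simp add: selection_principle_def Gfin_def Sfin_def)

text \<open>Alice's family is replaced by its image under \<open>\<phi>\<close>, and Bob answers
  with a preimage of the selected set. The restriction \<open>\<V> \<subseteq> \<Union>\<A>'\<close>
  records that his selections come from legal moves.\<close>

lemma reducible_G1:
  assumes "\<And>\<U>. \<U> \<in> \<A>' \<Longrightarrow> \<phi> ` \<U> \<in> \<A>"
    and "\<And>\<V>. \<V> \<subseteq> \<Union>\<A>' \<Longrightarrow> \<phi> ` \<V> \<in> \<B> \<Longrightarrow> \<V> \<in> \<B>'"
  shows "reducible (G1 \<A> \<B>) (G1 \<A>' \<B>')"
proof -
  have "game_reduction (G1 \<A> \<B>) (G1 \<A>' \<B>') ((`) \<phi>) (\<lambda>\<U>. inv_into \<U> \<phi>)"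
    unfolding game_reduction_def
  proof (intro conjI allI ballI impI)
    fix m and r :: "nat \<Rightarrow> _"
    assume m: "\<forall>n. m n \<in> moves (G1 \<A>' \<B>')"
      and r: "\<forall>n. r n \<in> answers (G1 \<A> \<B>) (\<phi> ` m n)" "r \<in> bob_wins (G1 \<A> \<B>)"
    \<comment> \<open>Inverting \<open>\<phi>\<close> within the family just played keeps the answer
      legal even if \<open>\<phi>\<close> is not injective.\<close>
    let ?s = "\<lambda>n. inv_into (m n) \<phi> (r n)"
    have "?s n \<in> m n" "\<phi> (?s n) = r n" for n
      using r(1) by (simp_all add: G1_def inv_into_into f_inv_into_f)
    then have "range ?s \<subseteq> \<Union>\<A>'" "\<phi> ` range ?s = range r"
      using m by (fastforce simp: G1_def, simp add: image_image)
    then show "?s \<in> bob_wins (G1 \<A>' \<B>')"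
      using assms(2)[of "range ?s"] r(2) by (simp add: G1_def)
  qed (use assms(1) in \<open>auto simp: G1_def intro: inv_into_into\<close>)
  then show ?thesis by (auto simp: reducible_def)
qed

lemma reducible_Gfin:
  assumes "\<And>\<U>. \<U> \<in> \<A>' \<Longrightarrow> \<phi> ` \<U> \<in> \<A>"
    and "\<And>\<V>. \<V> \<subseteq> \<Union>\<A>' \<Longrightarrow> \<phi> ` \<V> \<in> \<B> \<Longrightarrow> \<V> \<in> \<B>'"
  shows "reducible (Gfin \<A> \<B>) (Gfin \<A>' \<B>')"
proof -
  have "game_reduction (Gfin \<A> \<B>) (Gfin \<A>' \<B>') ((`) \<phi>) (\<lambda>\<U> \<V>. inv_into \<U> \<phi> ` \<V>)"
    unfolding game_reduction_def
  proof (intro conjI allI ballI impI)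
    fix m and r :: "nat \<Rightarrow> _"
    assume m: "\<forall>n. m n \<in> moves (Gfin \<A>' \<B>')"
      and r: "\<forall>n. r n \<in> answers (Gfin \<A> \<B>) (\<phi> ` m n)" "r \<in> bob_wins (Gfin \<A> \<B>)"
    let ?s = "\<lambda>n. inv_into (m n) \<phi> ` r n"
    have rm: "r n \<subseteq> \<phi> ` m n" for n
      using r(1) by (simp add: Gfin_def)
    \<comment> \<open>One preimage for each selected set is enough: the chosen family still maps
      onto \<open>r n\<close>.\<close>
    then have "?s n \<subseteq> m n" "\<phi> ` ?s n = r n" for n
      by (blast intro: inv_into_into, simp add: image_inv_into_cancel[OF refl])
    then have "(\<Union>n. ?s n) \<subseteq> \<Union>\<A>'" "\<phi> ` (\<Union>n. ?s n) = (\<Union>n. r n)"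
      using m by (fastforce simp: Gfin_def, simp add: image_UN)
    then show "?s \<in> bob_wins (Gfin \<A>' \<B>')"
      using assms(2)[of "\<Union>n. ?s n"] r(2) by (simp add: Gfin_def)
  qed (use assms(1) in \<open>auto simp: Gfin_def intro: inv_into_into\<close>)
  then show ?thesis by (auto simp: reducible_def)
qed

section \<open>Covers for the induced convergence\<close>

text \<open>Every convergent filter contains a neighbourhood filter, so it suffices to meet these,
  and a subset of the space belongs to the one at \<open>x\<close> iff \<open>x\<close> lies in its
  interior.\<close>

lemma conv_covers_induced_convergence:
  "conv_covers (topspace T) (induced_convergence T) =
     {\<U>. \<U> \<subseteq> Pow (topspace T) \<and> (\<Union>U\<in>\<U>. T interior_of U) = topspace T}"
    (is "?C = ?I")
proof (rule set_eqI, rule iffI)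
  fix \<U> assume \<U>: "\<U> \<in> ?C"
  have "\<exists>U\<in>\<U>. x \<in> T interior_of U" if x: "x \<in> topspace T" for x
  proof -
    \<comment> \<open>The cover is tested against the neighbourhood filter of \<open>x\<close>,
      which is proper since each neighbourhood contains \<open>x\<close>.\<close>
    have "nhdsin T x \<noteq> bot"
      using x by (auto simp: trivial_limit_def eventually_nhdsin)
    moreover have "nhdsin T x \<le> principal (topspace T)"
      using x by (auto simp: le_principal eventually_nhdsin)
    ultimately have "nhdsin T x \<in> convergent_filters (topspace T) (induced_convergence T)"
      using x by (auto simp: convergent_filters_def Fil_def induced_convergence_def)
    then obtain U where "U \<in> \<U>" "eventually (\<lambda>y. y \<in> U) (nhdsin T x)"
      using \<U> unfolding conv_covers_def filter_sets_def by blast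
    then show ?thesis
      using x by (auto simp: eventually_nhdsin interior_of_def)
  qed
  then show "\<U> \<in> ?I"
    using \<U> interior_of_subset_topspace[of T] by (auto simp: conv_covers_def)
next
  fix \<U> assume \<U>: "\<U> \<in> ?I"
  have "\<U> \<inter> filter_sets (topspace T) F \<noteq> {}"
    if F: "F \<in> convergent_filters (topspace T) (induced_convergence T)" for F
  proof -
    obtain x where x: "x \<in> topspace T" "F \<le> nhdsin T x"
      using F by (auto simp: convergent_filters_def induced_convergence_def)
    then obtain U where U: "U \<in> \<U>" "x \<in> T interior_of U"
      using \<U> by blast
    then have "eventually (\<lambda>y. y \<in> U) (nhdsin T x)"
      using x(1) by (auto simp: eventually_nhdsin interior_of_def)
    then have "U \<in> filter_sets (topspace T) F"
      using x(2) U(1) \<U> by (auto simp: filter_sets_def le_filter_def)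
    with U(1) show ?thesis by blast
  qed
  then show "\<U> \<in> ?C"
    using \<U> by (simp add: conv_covers_def)
qed

lemma conv_covers_subset_all_covers:
  "conv_covers (topspace T) (induced_convergence T) \<subseteq> all_covers (topspace T)"
proof
  fix \<U> assume "\<U> \<in> conv_covers (topspace T) (induced_convergence T)"
  then have \<U>: "\<U> \<subseteq> Pow (topspace T)" "(\<Union>U\<in>\<U>. T interior_of U) = topspace T"
    by (simp_all add: conv_covers_induced_convergence)
  have "(\<Union>U\<in>\<U>. T interior_of U) \<subseteq> \<Union>\<U>"
    using interior_of_subset[of T] by blast
  with \<U> show "\<U> \<in> all_covers (topspace T)"
    by (auto simp: all_covers_def)
qed

lemma open_covers_subset_conv_covers:
  "open_covers T \<subseteq> conv_covers (topspace T) (induced_convergence T)"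
  unfolding open_covers_def conv_covers_induced_convergence
  by (auto simp: interior_of_openin dest: openin_subset)

text \<open>Interiors are open, so only the covering condition remains. Right to left makes the
  translated moves legal; left to right carries Bob's win back.\<close>

lemma open_cover_interiors_iff:
  assumes "\<U> \<subseteq> Pow (topspace T)"
  shows "(interior_of) T ` \<U> \<in> open_covers T \<longleftrightarrow>
    \<U> \<in> conv_covers (topspace T) (induced_convergence T)"
  using assms by (auto simp: open_covers_def conv_covers_induced_convergence)

lemma all_covers_imp_open_covers:
  assumes "\<V> \<subseteq> \<Union>(open_covers T)" and "\<V> \<in> all_covers (topspace T)"
  shows "\<V> \<in> open_covers T"
  using assms by (auto simp: open_covers_def all_covers_def)

theorem proposition2p1:
  fixes T :: "'a topology" and X :: "'a set" and L :: "'a filter \<Rightarrow> 'a set"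
  assumes "X = topspace T" and "L = induced_convergence T"
  shows "strategically_equivalent (G1 (conv_covers X L) (conv_covers X L))
           (G1 (open_covers T) (open_covers T)) \<and>
         strategically_equivalent (G1 (conv_covers X L) (all_covers X))
           (G1 (open_covers T) (open_covers T)) \<and>
         strategically_equivalent (Gfin (conv_covers X L) (conv_covers X L))
           (Gfin (open_covers T) (open_covers T)) \<and>
         strategically_equivalent (Gfin (conv_covers X L) (all_covers X))
           (Gfin (open_covers T) (open_covers T)) \<and>
         (S1 (conv_covers X L) (conv_covers X L) \<longleftrightarrow> S1 (open_covers T) (open_covers T)) \<and>
         (S1 (conv_covers X L) (all_covers X) \<longleftrightarrow> S1 (open_covers T) (open_covers T)) \<and>
         (Sfin (conv_covers X L) (conv_covers X L) \<longleftrightarrow> Sfin (open_covers T) (open_covers T)) \<and>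
         (Sfin (conv_covers X L) (all_covers X) \<longleftrightarrow> Sfin (open_covers T) (open_covers T))"
proof -
  let ?C = "conv_covers X L" and ?A = "all_covers X" and ?O = "open_covers T"
  note covers = assms conv_covers_subset_all_covers[of T] open_covers_subset_conv_covers[of T]
  have interiors: "(interior_of) T ` \<U> \<in> ?O \<longleftrightarrow> \<U> \<in> ?C" if "\<U> \<subseteq> \<Union>?C" for \<U>
    using open_cover_interiors_iff[of \<U> T] that assms by (auto simp: conv_covers_def)
  \<comment> \<open>Only Bob's goal changes, and it becomes weaker.\<close>
  have "reducible (G1 ?C ?C) (G1 ?C ?A)"
    by (rule reducible_G1[where \<phi> = id]) (use covers in auto)
  \<comment> \<open>Open covers are among the moves on the left, and a cover selected from open
    covers consists of open sets.\<close>
  moreover have "reducible (G1 ?C ?A) (G1 ?O ?O)"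
    by (rule reducible_G1[where \<phi> = id]) (use covers all_covers_imp_open_covers in auto)
  \<comment> \<open>\<open>interiors\<close> supplies both hypotheses of
    \<open>reducible_G1\<close>, one from each direction.\<close>
  moreover have "reducible (G1 ?O ?O) (G1 ?C ?C)"
    by (rule reducible_G1[where \<phi> = "(interior_of) T"]) (use interiors in auto)
  ultimately have G1: "strategically_equivalent (G1 ?C ?C) (G1 ?O ?O)"
      "strategically_equivalent (G1 ?C ?A) (G1 ?O ?O)"
      "S1 ?C ?C \<longleftrightarrow> S1 ?O ?O" "S1 ?C ?A \<longleftrightarrow> S1 ?O ?O"
    using reducible_cycle unfolding selection_principle_G1[symmetric] by blast+
  have "reducible (Gfin ?C ?C) (Gfin ?C ?A)"
    by (rule reducible_Gfin[where \<phi> = id]) (use covers in auto)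
  moreover have "reducible (Gfin ?C ?A) (Gfin ?O ?O)"
    by (rule reducible_Gfin[where \<phi> = id]) (use covers all_covers_imp_open_covers in auto)
  moreover have "reducible (Gfin ?O ?O) (Gfin ?C ?C)"
    by (rule reducible_Gfin[where \<phi> = "(interior_of) T"]) (use interiors in auto)
  ultimately have "strategically_equivalent (Gfin ?C ?C) (Gfin ?O ?O)"
      "strategically_equivalent (Gfin ?C ?A) (Gfin ?O ?O)"
      "Sfin ?C ?C \<longleftrightarrow> Sfin ?O ?O" "Sfin ?C ?A \<longleftrightarrow> Sfin ?O ?O"
    using reducible_cycle unfolding selection_principle_Gfin[symmetric] by blast+
  with G1 show ?thesis by blast
qed

end
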